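(* Let $q>c>0$ and $n\ge1$ be integers, and let $x$ be an integer with $$0\le x\le\begin{cases} c(q/c)^n-c & \text{if } c \text{ divides } q,\\ (q/c)^{n-1}(q-c) & \text{otherwise.}\end{cases}$$ Define $v_0=0$ and $v_{i+1}=\left\lfloor\frac{(v_i+1)c+x}{q}\right\rfloor$ for $i\ge 0$. Then $$\left\lfloor\frac{x}{q-c}\right\rfloor=v_n.$$ *)

theory Defs
  imports Complex_Main
begin

end

theory Submission
  imports Defs
begin

text \<open>
  Put \<open>m = \<lfloor>x / (q - c)\<rfloor>\<close>. Every \<open>v\<^sub>i\<close> is at most \<open>m\<close>, and the gap \<open>e\<^sub>i = m - 1 - v\<^sub>i\<close> satisfies
  \<open>q e\<^sub>i\<^sub>+\<^sub>1 < c e\<^sub>i\<close>. If \<open>v\<^sub>n < m\<close>, then \<open>e\<^sub>n \<ge> 0\<close>, so \<open>e\<^sub>n\<^sub>-\<^sub>1 \<ge> 1\<close> and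
  \<open>e\<^sub>0 = m - 1 \<ge> (q/c)\<^sup>n\<^sup>-\<^sup>1\<close>, which makes \<open>x \<ge> (q - c) m\<close> too large. If \<open>q = k c\<close>, integrality
  sharpens the recursion to \<open>e\<^sub>i \<ge> k e\<^sub>i\<^sub>+\<^sub>1 + 1\<close>, whence \<open>(k - 1) e\<^sub>0 \<ge> k\<^sup>n - 1\<close>.
\<close>

lemma mult_div_le_int:
  fixes a b :: int
  assumes "0 < b"
  shows "b * (a div b) \<le> a"
  using minus_mod_eq_mult_div[of a b] pos_mod_sign[OF assms, of a] by linarith

lemma less_mult_div_plus_1_int:
  fixes a b :: int
  assumes "0 < b"
  shows "a < b * (a div b + 1)"
  unfolding distrib_left
  using minus_mod_eq_mult_div[of a b] pos_mod_bound[OF assms, of a] by linarith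

text \<open>Since \<open>x < (q - c) * (m + 1)\<close> for \<open>m = x div (q - c)\<close>, any
  value at most \<open>m\<close> is sent to a quotient of something below
  \<open>q * (m + 1)\<close>, hence again to a value at most \<open>m\<close>.\<close>

lemma div_iteration_le:
  fixes q c x :: int and v :: "nat \<Rightarrow> int"
  assumes "0 < c" "c < q" "0 \<le> x" "v 0 = 0"
    and step: "\<And>i. v (Suc i) = ((v i + 1) * c + x) div q"
  shows "v i \<le> x div (q - c)"
proof (induction i)
  case 0
  then show ?case using assms by (simp add: pos_imp_zdiv_nonneg_iff)
next
  case (Suc i)
  let ?m = "x div (q - c)"
  have "x < (q - c) * (?m + 1)"
    using assms by (intro less_mult_div_plus_1_int) simp
  moreover have "(v i + 1) * c \<le> (?m + 1) * c"
    using Suc assms by (intro mult_right_mono) auto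
  ultimately have "(v i + 1) * c + x < q * (?m + 1)"
    by (simp add: algebra_simps)
  moreover have "q * (((v i + 1) * c + x) div q) \<le> (v i + 1) * c + x"
    using assms(1,2) by (intro mult_div_le_int) simp
  ultimately have "q * (((v i + 1) * c + x) div q) < q * (?m + 1)"
    by linarith
  then have "((v i + 1) * c + x) div q < ?m + 1"
    using assms(1,2) by (simp only: mult_less_cancel_left_pos)
  then show ?case by (simp add: step)
qed

text \<open>Adding the lower bound on \<open>x\<close> from the floor \<open>m\<close> to the upper
  bound from the floor of the step cancels \<open>x\<close>; strictness comes from the
  latter.\<close>

lemma div_iteration_gap:
  fixes q c x a :: int
  assumes "0 < c" "c < q"
  defines "m \<equiv> x div (q - c)"
  shows "q * (m - 1 - ((a + 1) * c + x) div q) < c * (m - 1 - a)"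
proof -
  let ?b = "((a + 1) * c + x) div q"
  have "(q - c) * m \<le> x"
    unfolding m_def using assms(2) by (intro mult_div_le_int) simp
  moreover have "(a + 1) * c + x < q * (?b + 1)"
    using assms(1,2) by (intro less_mult_div_plus_1_int) simp
  ultimately show ?thesis by (simp add: algebra_simps)
qed

text \<open>Division-free form of geometric decay, applied with ratio \<open>1 / k\<close> when
  \<open>c dvd q\<close> and with ratio \<open>c / q\<close> otherwise.\<close>

lemma geometric_descent:
  fixes q c :: "'a::linordered_idom" and e :: "nat \<Rightarrow> 'a"
  assumes "0 \<le> c" "0 \<le> q" and "\<And>i. q * e (Suc i) \<le> c * e i"
  shows "q ^ j * e j \<le> c ^ j * e 0"
proof (induction j)
  case (Suc j)
  have "q ^ Suc j * e (Suc j) = q ^ j * (q * e (Suc j))"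
    by (simp add: mult_ac)
  also have "\<dots> \<le> q ^ j * (c * e j)"
    using assms by (intro mult_left_mono) auto
  also have "\<dots> = c * (q ^ j * e j)"
    by (simp add: mult_ac)
  also have "\<dots> \<le> c * (c ^ j * e 0)"
    using assms Suc by (intro mult_left_mono) auto
  finally show ?case by (simp add: mult_ac)
qed simp

theorem theorem9:
  fixes q c x :: int and n :: nat and v :: "nat \<Rightarrow> int"
  assumes "q > c" and "c > 0" and "n \<ge> 1"
    and "0 \<le> x"
    and "real_of_int x \<le>
          (if c dvd q
           then real_of_int c * (real_of_int q / real_of_int c) ^ n - real_of_int c
           else (real_of_int q / real_of_int c) ^ (n - 1) * (real_of_int q - real_of_int c))"
    and "v 0 = 0"
    and "\<And>i. v (Suc i) =
          \<lfloor>((real_of_int (v i) + 1) * real_of_int c + real_of_int x) / real_of_int q\<rfloor>"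
  shows "\<lfloor>real_of_int x / (real_of_int q - real_of_int c)\<rfloor> = v n"
proof -
  define m where "m = x div (q - c)"
  define e where "e = (\<lambda>i. m - 1 - v i)"
  have step: "v (Suc i) = ((v i + 1) * c + x) div q" for i
    using floor_divide_of_int_eq[where 'a = real, of "(v i + 1) * c + x" q]
    by (simp add: assms(7))
  have gap: "q * e (Suc i) < c * e i" for i
    unfolding e_def m_def step using assms(1,2) by (intro div_iteration_gap)
  have e0: "e 0 = m - 1"
    by (simp add: e_def assms(6))
  have x_ge: "(q - c) * m \<le> x"
    unfolding m_def using assms(1) by (intro mult_div_le_int) simp
  have "\<not> v n < m"
  proof
    assume "v n < m"
    then have en: "0 \<le> e n" by (simp add: e_def)
    show False
    proof (cases "c dvd q")
      case True
      then obtain k where k: "q = c * k" ..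
      have k1: "k > 1" using assms(1,2) k by simp
      have "k * e (Suc i) + 1 \<le> e i" for i
      proof -
        have "c * (k * e (Suc i)) < c * e i" using gap[of i] k by (simp add: mult_ac)
        then show ?thesis using assms(2) by simp
      qed
      \<comment> \<open>The shift \<open>(k - 1) * e i + 1\<close> makes the affine recursion
        homogeneous, because
        \<open>k * ((k - 1) * t + 1) = (k - 1) * (k * t + 1) + 1\<close>.\<close>
      then have "k * ((k - 1) * e (Suc i) + 1) \<le> 1 * ((k - 1) * e i + 1)" for i
        using mult_left_mono[of "k * e (Suc i) + 1" "e i" "k - 1"] k1
        by (simp add: algebra_simps)
      from geometric_descent[where e = "\<lambda>i. (k - 1) * e i + 1", OF _ _ this, of n]
      have "k ^ n * ((k - 1) * e n + 1) \<le> (k - 1) * e 0 + 1"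
        using k1 by simp
      moreover have "k ^ n * 1 \<le> k ^ n * ((k - 1) * e n + 1)"
        using k1 en by (intro mult_left_mono) auto
      ultimately have "k ^ n - 1 < (k - 1) * m"
        using k1 by (simp add: e0 algebra_simps)
      then have "c * (k ^ n - 1) < c * ((k - 1) * m)"
        using assms(2) by simp
      with x_ge have "c * k ^ n - c < x"
        by (simp add: k algebra_simps)
      moreover have "real_of_int x \<le> real_of_int (c * k ^ n - c)"
        using assms(2,5) True by (simp add: k)
      ultimately show False by linarith
    next
      case False
      obtain p where p: "n = Suc p" using assms(3) by (cases n) auto
      have "0 \<le> q * e n" using en assms(1,2) by simp
      \<comment> \<open>Strictness of the last gap lifts \<open>e n \<ge> 0\<close> to
        \<open>e p \<ge> 1\<close>. Only \<open>p = n - 1\<close> steps remain for the descent,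
        hence the exponent \<open>n - 1\<close> in the bound.\<close>
      with gap[of p] have "0 < c * e p" by (simp add: p)
      then have ep: "1 \<le> e p" using assms(2) by (simp add: zero_less_mult_iff)
      have "q ^ p * 1 \<le> q ^ p * e p"
        using ep assms(1,2) by (intro mult_left_mono) auto
      also have "\<dots> \<le> c ^ p * e 0"
        using assms(1,2) gap by (intro geometric_descent) (auto intro: less_imp_le)
      also have "\<dots> < c ^ p * m"
        using assms(2) by (simp add: e0)
      finally have "q ^ p * (q - c) < c ^ p * m * (q - c)"
        using assms(1) by simp
      also have "\<dots> \<le> c ^ p * x"
        using x_ge assms(2) by (simp add: mult_ac)
      \<comment> \<open>This contradicts the assumed bound on \<open>x\<close> once its denominator
        \<open>c ^ p\<close> is cleared.\<close>
      finally have "real_of_int (q ^ p * (q - c)) < real_of_int (c ^ p * x)"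
        by (simp only: of_int_less_iff)
      then show False
        using assms(2,5) False by (simp add: p power_divide field_simps)
    qed
  qed
  moreover have "v n \<le> m"
    unfolding m_def using assms step by (intro div_iteration_le) auto
  moreover have "\<lfloor>real_of_int x / (real_of_int q - real_of_int c)\<rfloor> = m"
    using floor_divide_of_int_eq[where 'a = real, of x "q - c"] by (simp add: m_def)
  ultimately show ?thesis by simp
qed

end
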